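(* Let $N_p\ge1$, let $\omega_1,\dots,\omega_{N_p}$ be nonzero real constants, and let $\mathbf{B}_0:\Omega_x\to\mathbb{R}^3$ be a smooth vector field on an open set $\Omega_x\subset\mathbb{R}^3$ with $\nabla\cdot\mathbf{B}_0(\mathbf{x})=0$. For smooth functions $F,G$ of $(\mathbf{X},\mathbf{V})$, where $\mathbf{X}=(\mathbf{X}_1,\dots,\mathbf{X}_{N_p})\in\Omega_x^{N_p}$ and $\mathbf{V}=(\mathbf{V}_1,\dots,\mathbf{V}_{N_p})\in(\mathbb{R}^3)^{N_p}$, define $$\{F,G\}(\mathbf{X},\mathbf{V})=\sum_{s=1}^{N_p}\frac{1}{\omega_s}\left(\frac{\partial F}{\partial\mathbf{X}_s}\cdot\frac{\partial G}{\partial\mathbf{V}_s}-\frac{\partial G}{\partial\mathbf{X}_s}\cdot\frac{\partial F}{\partial\mathbf{V}_s}\right)+\sum_{s=1}^{N_p}\frac{1}{\omega_s}\mathbf{B}_0(\mathbf{X}_s)\cdot\left(\frac{\partial F}{\partial\mathbf{V}_s}\times\frac{\partial G}{\partial\mathbf{V}_s}\right).$$ Then $\{\cdot,\cdot\}$ is a Poisson bracket.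
   Context: A Poisson bracket on smooth functions is a bilinear, skew-symmetric operation $\{\cdot,\cdot\}$ satisfying the Leibniz rule $\{FG,H\}=F\{G,H\}+G\{F,H\}$ and the Jacobi identity $\{\{F,G\},H\}+\{\{G,H\},F\}+\{\{H,F\},G\}=0$. The quantities $\omega_s$ are the (constant) particle weights. *)

theory Defs
  imports "HOL-Analysis.Analysis"
begin

primrec k_smooth_on ::
  "nat \<Rightarrow> 'a::real_normed_vector set \<Rightarrow> ('a \<Rightarrow> 'b::real_normed_vector) \<Rightarrow> bool" where
  "k_smooth_on 0 S f \<longleftrightarrow> continuous_on S f"
| "k_smooth_on (Suc k) S f \<longleftrightarrow> (\<forall>x\<in>S. f differentiable (at x)) \<and>
     (\<forall>v. k_smooth_on k S (\<lambda>x. frechet_derivative f (at x) v))"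

text \<open>Used for open sets in finite-dimensional spaces only, where it is the usual notion
  of a \<open>C\<^sup>\<infinity>\<close> function: every iterated directional derivative exists and is continuous.\<close>

definition smooth_on ::
  "'a::real_normed_vector set \<Rightarrow> ('a \<Rightarrow> 'b::real_normed_vector) \<Rightarrow> bool" where
  "smooth_on S f \<longleftrightarrow> (\<forall>k. k_smooth_on k S f)"

definition divergence :: "(real^3 \<Rightarrow> real^3) \<Rightarrow> real^3 \<Rightarrow> real" where
  "divergence B x = (\<Sum>i\<in>UNIV. frechet_derivative B (at x) (axis i 1) $ i)"

text \<open>A phase-space point is a pair \<open>(X, V)\<close> of families of positions and velocities
  indexed by the finite nonempty type \<open>'n\<close> of particles, so that \<open>N\<^sub>p = CARD('n)\<close>.\<close>

type_synonym 'n phase = "((real^3)^'n) \<times> ((real^3)^'n)"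

definition phase_space :: "(real^3) set \<Rightarrow> ('n::finite) phase set" where
  "phase_space \<Omega> = {(X, V). \<forall>s. X $ s \<in> \<Omega>}"

definition grad_X :: "'n::finite \<Rightarrow> ('n phase \<Rightarrow> real) \<Rightarrow> 'n phase \<Rightarrow> real^3" where
  "grad_X s F z = (\<chi> i. frechet_derivative F (at z) (axis s (axis i 1), 0))"

definition grad_V :: "'n::finite \<Rightarrow> ('n phase \<Rightarrow> real) \<Rightarrow> 'n phase \<Rightarrow> real^3" where
  "grad_V s F z = (\<chi> i. frechet_derivative F (at z) (0, axis s (axis i 1)))"

definition particle_bracket ::
  "('n::finite \<Rightarrow> real) \<Rightarrow> (real^3 \<Rightarrow> real^3) \<Rightarrow>
   ('n phase \<Rightarrow> real) \<Rightarrow> ('n phase \<Rightarrow> real) \<Rightarrow> 'n phase \<Rightarrow> real" where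
  "particle_bracket \<omega> B F G z =
     (\<Sum>s\<in>UNIV. (1 / \<omega> s) * (grad_X s F z \<bullet> grad_V s G z - grad_X s G z \<bullet> grad_V s F z))
   + (\<Sum>s\<in>UNIV. (1 / \<omega> s) * (B (fst z $ s) \<bullet> cross3 (grad_V s F z) (grad_V s G z)))"

text \<open>Smooth functions on an open set \<open>M\<close> are represented by total functions, two of which
  denote the same element of \<open>C\<^sup>\<infinity>(M)\<close> iff they agree on \<open>M\<close>. Hence all identities are
  required on \<open>M\<close>, and the first two clauses say that the bracket is a well-defined
  binary operation on \<open>C\<^sup>\<infinity>(M)\<close>.\<close>

definition poisson_bracket_on ::
  "'a::real_normed_vector set \<Rightarrow> (('a \<Rightarrow> real) \<Rightarrow> ('a \<Rightarrow> real) \<Rightarrow> 'a \<Rightarrow> real) \<Rightarrow> bool" where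
  "poisson_bracket_on M br \<longleftrightarrow>
     (\<forall>F G. smooth_on M F \<longrightarrow> smooth_on M G \<longrightarrow> smooth_on M (br F G)) \<and>
     (\<forall>F F' G G'. smooth_on M F \<longrightarrow> smooth_on M F' \<longrightarrow> smooth_on M G \<longrightarrow> smooth_on M G' \<longrightarrow>
        (\<forall>z\<in>M. F z = F' z) \<longrightarrow> (\<forall>z\<in>M. G z = G' z) \<longrightarrow> (\<forall>z\<in>M. br F G z = br F' G' z)) \<and>
     (\<forall>F G H a b. smooth_on M F \<longrightarrow> smooth_on M G \<longrightarrow> smooth_on M H \<longrightarrow>
        (\<forall>z\<in>M. br (\<lambda>w. a * F w + b * G w) H z = a * br F H z + b * br G H z)) \<and>
     (\<forall>F G H a b. smooth_on M F \<longrightarrow> smooth_on M G \<longrightarrow> smooth_on M H \<longrightarrow>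
        (\<forall>z\<in>M. br H (\<lambda>w. a * F w + b * G w) z = a * br H F z + b * br H G z)) \<and>
     (\<forall>F G. smooth_on M F \<longrightarrow> smooth_on M G \<longrightarrow> (\<forall>z\<in>M. br F G z = - br G F z)) \<and>
     (\<forall>F G H. smooth_on M F \<longrightarrow> smooth_on M G \<longrightarrow> smooth_on M H \<longrightarrow>
        (\<forall>z\<in>M. br (\<lambda>w. F w * G w) H z = F z * br G H z + G z * br F H z)) \<and>
     (\<forall>F G H. smooth_on M F \<longrightarrow> smooth_on M G \<longrightarrow> smooth_on M H \<longrightarrow>
        (\<forall>z\<in>M. br (br F G) H z + br (br G H) F z + br (br H F) G z = 0))"

end

theory Submission
  imports Defs
begin

text \<open>
  The bracket has the form \<open>{F, G} = \<Sum>\<^sub>i\<^sub>j P\<^sub>i\<^sub>j D\<^sub>iF D\<^sub>jG\<close>, where \<open>D\<^sub>i\<close> is the derivative along one of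
  finitely many constant directions and the coefficient matrix \<open>P\<close> is smooth and antisymmetric.
  For every such bracket the algebraic axioms are immediate from the rules for derivatives, and
  only the Jacobi identity needs an argument. In the cyclic sum, the terms with a second
  derivative of \<open>F\<close>, \<open>G\<close> or \<open>H\<close> cancel because \<open>P\<close> is antisymmetric and the \<open>D\<^sub>i\<close> commute on
  smooth functions (\<open>dir_deriv_commute\<close>). What is left is a trilinear form in the first derivatives,
  whose coefficients are the cyclic sums of \<open>\<Sum>\<^sub>k P\<^sub>k\<^sub>l D\<^sub>kP\<^sub>i\<^sub>j\<close>. So the bracket is Poisson as soon as these
  vanish (\<open>poisson_bracket_on_bivector_bracket\<close>).

  For the particle bracket, \<open>P\<close> depends on the positions only, and only its velocity-velocity
  block is not constant. Therefore \<open>\<Sum>\<^sub>k P\<^sub>k\<^sub>l D\<^sub>kP\<^sub>i\<^sub>j\<close> can be nonzero only when \<open>i\<close>, \<open>j\<close>, \<open>l\<close> are three velocity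
  components \<open>a\<close>, \<open>b\<close>, \<open>c\<close> of the same particle \<open>s\<close>, and then it equals
  \<open>\<omega>\<^sub>s\<^sup>-\<^sup>2 (\<partial>\<^sub>cB \<bullet> (e\<^sub>a \<times> e\<^sub>b))\<close> at the position of \<open>s\<close> (\<open>schouten_particle_tensor\<close>). The cyclic sum
  of \<open>\<partial>\<^sub>cB \<bullet> (e\<^sub>a \<times> e\<^sub>b)\<close> is \<open>div B\<close> times the determinant of \<open>e\<^sub>a\<close>, \<open>e\<^sub>b\<close>, \<open>e\<^sub>c\<close>
  (\<open>trace_triple_product\<close>), hence zero.
\<close>

section \<open>Directional derivatives\<close>

definition dir_deriv :: "'a::real_normed_vector \<Rightarrow> ('a \<Rightarrow> 'b::real_normed_vector) \<Rightarrow> 'a \<Rightarrow> 'b"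
  where "dir_deriv v f z = frechet_derivative f (at z) v"

lemma dir_deriv_eqI: "(f has_derivative f') (at z) \<Longrightarrow> dir_deriv v f z = f' v"
  unfolding dir_deriv_def using frechet_derivative_at by fastforce

lemma differentiable_has_derivative:
  "f differentiable (at z) \<Longrightarrow> (f has_derivative (\<lambda>v. dir_deriv v f z)) (at z)"
  unfolding dir_deriv_def using frechet_derivative_works by blast

lemma dir_deriv_const: "dir_deriv v (\<lambda>_. c) z = 0"
  by (rule dir_deriv_eqI) (rule has_derivative_const)

lemma dir_deriv_zero: "dir_deriv 0 f z = 0" if "f differentiable (at z)"
  using differentiable_has_derivative[OF that] has_derivative_bounded_linear
    linear_0[OF bounded_linear.linear] by blast

lemma dir_deriv_add:
  assumes "f differentiable (at z)" "g differentiable (at z)"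
  shows "dir_deriv v (\<lambda>w. f w + g w) z = dir_deriv v f z + dir_deriv v g z"
  by (intro dir_deriv_eqI has_derivative_add differentiable_has_derivative assms)

lemma dir_deriv_sum:
  assumes "\<And>i. i \<in> I \<Longrightarrow> f i differentiable (at z)"
  shows "dir_deriv v (\<lambda>w. \<Sum>i\<in>I. f i w) z = (\<Sum>i\<in>I. dir_deriv v (f i) z)"
  by (intro dir_deriv_eqI has_derivative_sum differentiable_has_derivative assms)

lemma dir_deriv_mult:
  fixes f g :: "'a::real_normed_vector \<Rightarrow> real"
  assumes "f differentiable (at z)" "g differentiable (at z)"
  shows "dir_deriv v (\<lambda>w. f w * g w) z = f z * dir_deriv v g z + dir_deriv v f z * g z"
  by (intro dir_deriv_eqI has_derivative_mult differentiable_has_derivative assms)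

lemma dir_deriv_cmult:
  fixes f :: "'a::real_normed_vector \<Rightarrow> real"
  assumes "f differentiable (at z)"
  shows "dir_deriv v (\<lambda>w. c * f w) z = c * dir_deriv v f z"
  by (intro dir_deriv_eqI has_derivative_mult_right differentiable_has_derivative assms)

lemma dir_deriv_bounded_linear_left:
  assumes "bounded_linear h" "f differentiable (at z)"
  shows "dir_deriv v (\<lambda>w. h (f w)) z = h (dir_deriv v f z)"
  by (intro dir_deriv_eqI bounded_linear.has_derivative[OF assms(1)]
      differentiable_has_derivative assms)

lemma has_derivative_bounded_linear_right:
  assumes "bounded_linear L" "f differentiable (at (L z))"
  shows "((\<lambda>w. f (L w)) has_derivative (\<lambda>v. dir_deriv (L v) f (L z))) (at z)"
proof -
  have "(f \<circ> L has_derivative (\<lambda>v. dir_deriv v f (L z)) \<circ> L) (at z)"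
    by (intro diff_chain_at bounded_linear_imp_has_derivative differentiable_has_derivative assms)
  then show ?thesis by (simp add: o_def)
qed

lemma dir_deriv_bounded_linear_right:
  assumes "bounded_linear L" "f differentiable (at (L z))"
  shows "dir_deriv v (\<lambda>w. f (L w)) z = dir_deriv (L v) f (L z)"
  by (intro dir_deriv_eqI has_derivative_bounded_linear_right assms)

lemma dir_deriv_cong:
  assumes "open S" "z \<in> S" "\<And>w. w \<in> S \<Longrightarrow> f w = g w"
  shows "dir_deriv v f z = dir_deriv v g z"
proof -
  have "(f has_derivative f') (at z) \<longleftrightarrow> (g has_derivative f') (at z)" for f'
    using has_derivative_transform_within_open[OF _ assms(1,2), of f f' UNIV g]
      has_derivative_transform_within_open[OF _ assms(1,2), of g f' UNIV f] assms(3) by auto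
  then show ?thesis unfolding dir_deriv_def frechet_derivative_def by simp
qed

lemma differentiable_cong:
  assumes "open S" "z \<in> S" "\<And>w. w \<in> S \<Longrightarrow> f w = g w" "f differentiable (at z)"
  shows "g differentiable (at z)"
  using has_derivative_transform_within_open[OF _ assms(1,2), of f _ UNIV g] assms(3,4)
  unfolding differentiable_def by auto

section \<open>Smooth functions\<close>

lemma k_smooth_on_Suc:
  "k_smooth_on (Suc k) S f \<longleftrightarrow>
     (\<forall>x\<in>S. f differentiable (at x)) \<and> (\<forall>v. k_smooth_on k S (dir_deriv v f))"
proof -
  have "dir_deriv v f = (\<lambda>x. frechet_derivative f (at x) v)" for v
    by (simp add: dir_deriv_def fun_eq_iff)
  then show ?thesis by simp
qed

declare k_smooth_on.simps(2) [simp del]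

lemma k_smooth_on_SucD: "k_smooth_on (Suc k) S f \<Longrightarrow> k_smooth_on k S f"
proof (induction k arbitrary: f)
  case 0
  then show ?case
    by (auto simp: k_smooth_on_Suc intro!: continuous_at_imp_continuous_on
        differentiable_imp_continuous_within)
next
  case (Suc k)
  then show ?case by (metis k_smooth_on_Suc)
qed

text \<open>Calculus rules describe the derivative of a compound function only at points of \<open>S\<close>, while
  \<open>k_smooth_on\<close> speaks of derivatives as total functions. This lemma lets each closure property
  below replace the derivative by the expression that the calculus rule gives on \<open>S\<close>.\<close>

lemma k_smooth_on_cong:
  assumes "open S"
  shows "(\<And>z. z \<in> S \<Longrightarrow> f z = g z) \<Longrightarrow> k_smooth_on k S f \<Longrightarrow> k_smooth_on k S g"
proof (induction k arbitrary: f g)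
  case 0
  then show ?case using continuous_on_cong[of S S f g] by simp
next
  case (Suc k)
  have "k_smooth_on k S (dir_deriv v g)" for v
  proof (rule Suc.IH[of "dir_deriv v f"])
    show "dir_deriv v f z = dir_deriv v g z" if "z \<in> S" for z
      using dir_deriv_cong[OF assms that] Suc.prems(1) by blast
    show "k_smooth_on k S (dir_deriv v f)" using Suc.prems(2) by (simp add: k_smooth_on_Suc)
  qed
  moreover have "g differentiable (at z)" if "z \<in> S" for z
    using differentiable_cong[OF assms that, of f g] Suc.prems that
    by (simp add: k_smooth_on_Suc)
  ultimately show ?case by (simp add: k_smooth_on_Suc)
qed

lemma k_smooth_on_const: "k_smooth_on k S (\<lambda>_. c)"
proof (induction k arbitrary: c)
  case (Suc k)
  have "dir_deriv v (\<lambda>_. c) = (\<lambda>_. 0)" for v :: 'a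
    by (rule ext) (rule dir_deriv_const)
  then show ?case using Suc by (simp add: k_smooth_on_Suc)
qed simp

lemma k_smooth_on_add:
  assumes "open S"
  shows "k_smooth_on k S f \<Longrightarrow> k_smooth_on k S g \<Longrightarrow> k_smooth_on k S (\<lambda>w. f w + g w)"
proof (induction k arbitrary: f g)
  case 0
  then show ?case by (auto intro: continuous_on_add)
next
  case (Suc k)
  have "k_smooth_on k S (dir_deriv v (\<lambda>w. f w + g w))" for v
    by (rule k_smooth_on_cong[OF assms, of "\<lambda>w. dir_deriv v f w + dir_deriv v g w"])
      (use Suc in \<open>auto simp: k_smooth_on_Suc dir_deriv_add\<close>)
  then show ?case using Suc.prems by (simp add: k_smooth_on_Suc)
qed

lemma k_smooth_on_mult:
  fixes f g :: "'a::real_normed_vector \<Rightarrow> real"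
  assumes "open S"
  shows "k_smooth_on k S f \<Longrightarrow> k_smooth_on k S g \<Longrightarrow> k_smooth_on k S (\<lambda>w. f w * g w)"
proof (induction k arbitrary: f g)
  case 0
  then show ?case by (auto intro: continuous_on_mult)
next
  case (Suc k)
  have "k_smooth_on k S (\<lambda>w. f w * dir_deriv v g w + dir_deriv v f w * g w)" for v
    using Suc k_smooth_on_SucD k_smooth_on_Suc by (metis (mono_tags) assms k_smooth_on_add)
  then have "k_smooth_on k S (dir_deriv v (\<lambda>w. f w * g w))" for v
    by (rule k_smooth_on_cong[OF assms, rotated])
      (use Suc.prems in \<open>auto simp: k_smooth_on_Suc dir_deriv_mult\<close>)
  then show ?case using Suc.prems by (simp add: k_smooth_on_Suc)
qed

lemma k_smooth_on_bounded_linear_left: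
  assumes "open S" "bounded_linear h"
  shows "k_smooth_on k S f \<Longrightarrow> k_smooth_on k S (\<lambda>w. h (f w))"
proof (induction k arbitrary: f)
  case 0
  then show ?case by (simp add: bounded_linear.continuous_on[OF assms(2)])
next
  case (Suc k)
  have "k_smooth_on k S (dir_deriv v (\<lambda>w. h (f w)))" for v
    by (rule k_smooth_on_cong[OF assms(1), of "\<lambda>w. h (dir_deriv v f w)"])
      (use Suc in \<open>auto simp: k_smooth_on_Suc dir_deriv_bounded_linear_left[OF assms(2)]\<close>)
  moreover have "(\<lambda>w. h (f w)) differentiable (at z)" if "z \<in> S" for z
    using bounded_linear.has_derivative[OF assms(2)] that Suc.prems
    unfolding k_smooth_on_Suc differentiable_def by blast
  ultimately show ?case by (simp add: k_smooth_on_Suc)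
qed

lemma k_smooth_on_bounded_linear_right:
  assumes "open T" "bounded_linear L" "L ` T \<subseteq> S"
  shows "k_smooth_on k S f \<Longrightarrow> k_smooth_on k T (\<lambda>w. f (L w))"
proof (induction k arbitrary: f)
  case 0
  then show ?case
    using continuous_on_compose2[of S f T L] linear_continuous_on[OF assms(2)] assms(3) by simp
next
  case (Suc k)
  have diff: "f differentiable (at (L z))" if "z \<in> T" for z
    using Suc.prems assms(3) that by (auto simp: k_smooth_on_Suc)
  have "k_smooth_on k T (dir_deriv v (\<lambda>w. f (L w)))" for v
    by (rule k_smooth_on_cong[OF assms(1), of "\<lambda>w. dir_deriv (L v) f (L w)"])
      (use Suc in \<open>auto simp: k_smooth_on_Suc dir_deriv_bounded_linear_right[OF assms(2) diff]\<close>)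
  moreover have "(\<lambda>w. f (L w)) differentiable (at z)" if "z \<in> T" for z
    using has_derivative_bounded_linear_right[OF assms(2) diff[OF that]]
    unfolding differentiable_def by blast
  ultimately show ?case by (simp add: k_smooth_on_Suc)
qed

lemma smooth_on_differentiable: "smooth_on S f \<Longrightarrow> z \<in> S \<Longrightarrow> f differentiable (at z)"
  unfolding smooth_on_def using k_smooth_on_Suc by blast

lemma smooth_on_dir_deriv: "smooth_on S f \<Longrightarrow> smooth_on S (dir_deriv v f)"
  unfolding smooth_on_def using k_smooth_on_Suc by blast

lemma smooth_on_continuous_on: "smooth_on S f \<Longrightarrow> continuous_on S f"
  unfolding smooth_on_def by (metis k_smooth_on.simps(1))

lemma smooth_on_const: "smooth_on S (\<lambda>_. c)"
  by (simp add: smooth_on_def k_smooth_on_const)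

lemma smooth_on_mult:
  fixes f g :: "'a::real_normed_vector \<Rightarrow> real"
  shows "open S \<Longrightarrow> smooth_on S f \<Longrightarrow> smooth_on S g \<Longrightarrow> smooth_on S (\<lambda>w. f w * g w)"
  by (simp add: smooth_on_def k_smooth_on_mult)

lemma smooth_on_sum:
  assumes "open S" "\<And>i. i \<in> I \<Longrightarrow> smooth_on S (f i)"
  shows "smooth_on S (\<lambda>w. \<Sum>i\<in>I. f i w)"
  using assms(2)
  by (induction I rule: infinite_finite_induct)
    (simp_all add: smooth_on_def k_smooth_on_const k_smooth_on_add[OF assms(1)])

section \<open>Symmetry of second derivatives\<close>

text \<open>The second difference of \<open>f\<close> over the parallelogram with sides \<open>h u\<close>, \<open>h v\<close> is symmetric in \<open>u\<close>
  and \<open>v\<close>, but applying the mean value theorem first along \<open>u\<close> and then along \<open>v\<close> expresses it by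
  the mixed derivative in that order. Comparing both orders for small \<open>h\<close> gives Schwarz's
  theorem.\<close>

lemma second_difference_mvt:
  fixes f :: "'a::real_normed_vector \<Rightarrow> real"
  assumes "h > 0"
    and inS: "\<And>s t. 0 \<le> s \<Longrightarrow> s \<le> h \<Longrightarrow> 0 \<le> t \<Longrightarrow> t \<le> h \<Longrightarrow> z + s *\<^sub>R u + t *\<^sub>R v \<in> S"
    and f: "\<And>x. x \<in> S \<Longrightarrow> f differentiable (at x)"
    and fu: "\<And>x. x \<in> S \<Longrightarrow> dir_deriv u f differentiable (at x)"
  shows "\<exists>s t. 0 \<le> s \<and> s \<le> h \<and> 0 \<le> t \<and> t \<le> h \<and>
    f (z + h *\<^sub>R u + h *\<^sub>R v) - f (z + h *\<^sub>R u) - f (z + h *\<^sub>R v) + f z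
      = h * h * dir_deriv v (dir_deriv u f) (z + s *\<^sub>R u + t *\<^sub>R v)"
proof -
  have along: "((\<lambda>s. g (a + s *\<^sub>R w)) has_real_derivative dir_deriv w g (a + s *\<^sub>R w)) (at s)"
    if g: "g differentiable (at (a + s *\<^sub>R w))" for g :: "'a \<Rightarrow> real" and a w s
  proof -
    have "((\<lambda>s. a + s *\<^sub>R w) has_vector_derivative w) (at s)"
      by (auto intro!: derivative_eq_intros)
    from vector_derivative_diff_chain_within[OF this, of g "\<lambda>v. dir_deriv v g (a + s *\<^sub>R w)"]
    show ?thesis
      using has_derivative_at_withinI[OF differentiable_has_derivative[OF g]]
      by (simp add: o_def has_real_derivative_iff_has_vector_derivative)
  qed
  define \<phi> where "\<phi> s = f ((z + h *\<^sub>R v) + s *\<^sub>R u) - f (z + s *\<^sub>R u)" for s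
  have "(\<phi> has_real_derivative dir_deriv u f ((z + h *\<^sub>R v) + s *\<^sub>R u) - dir_deriv u f (z + s *\<^sub>R u))
      (at s)" if "0 \<le> s" "s \<le> h" for s
    unfolding \<phi>_def using inS[of s h] inS[of s 0] that \<open>h > 0\<close>
    by (intro DERIV_diff along f) (auto simp: algebra_simps)
  from MVT2[OF \<open>h > 0\<close> this] obtain s where s: "0 < s" "s < h" and
    1: "\<phi> h - \<phi> 0 = h * (dir_deriv u f ((z + h *\<^sub>R v) + s *\<^sub>R u) - dir_deriv u f (z + s *\<^sub>R u))"
    by auto
  have "((\<lambda>t. dir_deriv u f ((z + s *\<^sub>R u) + t *\<^sub>R v)) has_real_derivative
      dir_deriv v (dir_deriv u f) ((z + s *\<^sub>R u) + t *\<^sub>R v)) (at t)" if "0 \<le> t" "t \<le> h" for t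
    using inS[of s t] that s by (intro along fu) auto
  from MVT2[OF \<open>h > 0\<close> this] obtain t where t: "0 < t" "t < h" and
    2: "dir_deriv u f ((z + s *\<^sub>R u) + h *\<^sub>R v) - dir_deriv u f (z + s *\<^sub>R u)
      = h * dir_deriv v (dir_deriv u f) ((z + s *\<^sub>R u) + t *\<^sub>R v)"
    by auto
  have "f (z + h *\<^sub>R u + h *\<^sub>R v) - f (z + h *\<^sub>R u) - f (z + h *\<^sub>R v) + f z = \<phi> h - \<phi> 0"
    by (simp add: \<phi>_def algebra_simps)
  also have "\<dots> = h * h * dir_deriv v (dir_deriv u f) (z + s *\<^sub>R u + t *\<^sub>R v)"
    using 1 2 by (simp add: algebra_simps)
  finally show ?thesis using s t by (meson less_imp_le)
qed

text \<open>By the previous lemma, each of the two mixed derivatives takes at some point near \<open>z\<close> the value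
  of the same second difference divided by \<open>h\<^sup>2\<close>. Continuity carries the equality to \<open>z\<close>.\<close>

lemma dir_deriv_commute:
  fixes f :: "'a::real_normed_vector \<Rightarrow> real"
  assumes "open S" "smooth_on S f" "z \<in> S"
  shows "dir_deriv u (dir_deriv v f) z = dir_deriv v (dir_deriv u f) z"
proof -
  define a where "a = dir_deriv v (dir_deriv u f)"
  define b where "b = dir_deriv u (dir_deriv v f)"
  have "continuous_on S a" "continuous_on S b"
    unfolding a_def b_def by (intro smooth_on_continuous_on smooth_on_dir_deriv assms)+
  then have cont: "isCont a z" "isCont b z"
    using assms continuous_on_eq_continuous_at by blast+
  have "\<bar>a z - b z\<bar> \<le> e" if "e > 0" for e
  proof -
    obtain d1 where d1: "d1 > 0" "\<And>x. dist x z < d1 \<Longrightarrow> dist (a x) (a z) < e / 2"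
      using cont(1) \<open>e > 0\<close> unfolding continuous_at_eps_delta by (metis half_gt_zero)
    obtain d2 where d2: "d2 > 0" "\<And>x. dist x z < d2 \<Longrightarrow> dist (b x) (b z) < e / 2"
      using cont(2) \<open>e > 0\<close> unfolding continuous_at_eps_delta by (metis half_gt_zero)
    obtain d3 where d3: "d3 > 0" "ball z d3 \<subseteq> S"
      using assms(1,3) open_contains_ball by blast
    \<comment> \<open>\<open>h\<close> is so small that the parallelogram lies in the ball of radius \<open>d\<close>; the summand \<open>1\<close>
      keeps the denominator positive when \<open>u\<close> and \<open>v\<close> are \<open>0\<close>.\<close>
    define d where "d = min d1 (min d2 d3)"
    define h where "h = d / (2 * (norm u + norm v + 1))"
    have "d > 0" using d1 d2 d3 by (simp add: d_def)
    then have "h > 0" by (simp add: h_def add_nonneg_pos)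
    have near: "dist (z + s *\<^sub>R u + t *\<^sub>R v) z < d"
      if "0 \<le> s" "s \<le> h" "0 \<le> t" "t \<le> h" for s t
    proof -
      have "norm (s *\<^sub>R u + t *\<^sub>R v) \<le> s * norm u + t * norm v"
        using norm_triangle_ineq[of "s *\<^sub>R u" "t *\<^sub>R v"] that by simp
      also have "\<dots> \<le> h * norm u + h * norm v"
        using that by (intro add_mono mult_right_mono) auto
      also have "\<dots> \<le> h * (norm u + norm v + 1)"
        using \<open>h > 0\<close> by (simp add: algebra_simps)
      also have "\<dots> = d / 2"
      proof -
        have cancel: "d / (2 * c) * c = d / 2" if "c > 0" for c
          using that by simp
        show ?thesis unfolding h_def by (rule cancel) (simp add: add_nonneg_pos)
      qed
      finally show ?thesis using \<open>d > 0\<close> by (simp add: dist_norm add.assoc)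
    qed
    then have inS: "z + s *\<^sub>R u + t *\<^sub>R v \<in> S" if "0 \<le> s" "s \<le> h" "0 \<le> t" "t \<le> h" for s t
      using that d3(2) by (force simp: d_def dist_commute)
    have diff: "f differentiable (at x)" "dir_deriv w f differentiable (at x)" if "x \<in> S" for x w
      using that assms(2) smooth_on_differentiable smooth_on_dir_deriv by blast+
    have mvt: "\<exists>s t. 0 \<le> s \<and> s \<le> h \<and> 0 \<le> t \<and> t \<le> h \<and>
        f (z + h *\<^sub>R w + h *\<^sub>R w') - f (z + h *\<^sub>R w) - f (z + h *\<^sub>R w') + f z
          = h * h * dir_deriv w' (dir_deriv w f) (z + s *\<^sub>R w + t *\<^sub>R w')"
      if "\<And>s t. 0 \<le> s \<Longrightarrow> s \<le> h \<Longrightarrow> 0 \<le> t \<Longrightarrow> t \<le> h \<Longrightarrow> z + s *\<^sub>R w + t *\<^sub>R w' \<in> S"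
      for w w'
      by (rule second_difference_mvt[OF \<open>h > 0\<close>, of z w w' S]) (use that diff in auto)
    obtain s t where st: "0 \<le> s" "s \<le> h" "0 \<le> t" "t \<le> h" and
      1: "f (z + h *\<^sub>R u + h *\<^sub>R v) - f (z + h *\<^sub>R u) - f (z + h *\<^sub>R v) + f z
        = h * h * a (z + s *\<^sub>R u + t *\<^sub>R v)"
      using mvt[of u v, OF inS] unfolding a_def by blast
    have inS': "z + s *\<^sub>R v + t *\<^sub>R u \<in> S" if "0 \<le> s" "s \<le> h" "0 \<le> t" "t \<le> h" for s t
      using inS[of t s] that by (simp add: algebra_simps)
    obtain s' t' where st': "0 \<le> s'" "s' \<le> h" "0 \<le> t'" "t' \<le> h" and
      2: "f (z + h *\<^sub>R v + h *\<^sub>R u) - f (z + h *\<^sub>R v) - f (z + h *\<^sub>R u) + f z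
        = h * h * b (z + s' *\<^sub>R v + t' *\<^sub>R u)"
      using mvt[of v u, OF inS'] unfolding b_def by blast
    have swap: "z + h *\<^sub>R v + h *\<^sub>R u = z + h *\<^sub>R u + h *\<^sub>R v"
      "z + s' *\<^sub>R v + t' *\<^sub>R u = z + t' *\<^sub>R u + s' *\<^sub>R v"
      by (simp_all add: algebra_simps)
    have "h * h * a (z + s *\<^sub>R u + t *\<^sub>R v) = h * h * b (z + t' *\<^sub>R u + s' *\<^sub>R v)"
      using 1 2[unfolded swap] by linarith
    then have "a (z + s *\<^sub>R u + t *\<^sub>R v) = b (z + t' *\<^sub>R u + s' *\<^sub>R v)"
      using \<open>h > 0\<close> by simp
    moreover have "dist (a (z + s *\<^sub>R u + t *\<^sub>R v)) (a z) < e / 2"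
      using near[OF st] by (intro d1(2)) (simp add: d_def)
    moreover have "dist (b (z + t' *\<^sub>R u + s' *\<^sub>R v)) (b z) < e / 2"
      using near[of t' s'] st' by (intro d2(2)) (simp add: d_def)
    ultimately show ?thesis unfolding dist_real_def by linarith
  qed
  then have "a z = b z" using field_le_epsilon[of "\<bar>a z - b z\<bar>" 0] by auto
  then show ?thesis by (simp add: a_def b_def)
qed

section \<open>Brackets given by a bivector\<close>

lemma sum_rotate:
  "(\<Sum>i\<in>A. \<Sum>j\<in>B. \<Sum>l\<in>C. X i j l) = (\<Sum>l\<in>C. \<Sum>i\<in>A. \<Sum>j\<in>B. X i j l)"
  by (subst (2) sum.swap, subst sum.swap) (rule refl)

text \<open>With \<open>dp k i j\<close> standing for the derivative of \<open>p i j\<close> in direction \<open>k\<close>, the cyclic sum of this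
  expression over \<open>i\<close>, \<open>j\<close>, \<open>l\<close> is, up to a constant factor, a component of the Schouten bracket of
  the bivector \<open>p\<close> with itself.\<close>

definition schouten :: "('i::finite \<Rightarrow> 'i \<Rightarrow> real) \<Rightarrow> ('i \<Rightarrow> 'i \<Rightarrow> 'i \<Rightarrow> real) \<Rightarrow> 'i \<Rightarrow> 'i \<Rightarrow> 'i \<Rightarrow> real"
  where "schouten p dp i j l = (\<Sum>k\<in>UNIV. p k l * dp k i j)"

text \<open>The Jacobi identity at a single point, as an identity between numbers: \<open>f\<close> stands for the
  first derivatives of a function at the point and \<open>ff\<close> for its matrix of second derivatives,
  likewise \<open>g\<close> and \<open>h\<close>; \<open>B\<close> is the bracket of two differentials and \<open>D\<close> the
  differential of a bracket. With the Hamiltonian vectors \<open>ham v\<close>, a second-derivative term is the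
  value \<open>T ff (g, h)\<close> of the Hessian \<open>ff\<close> at \<open>ham g\<close> and \<open>ham h\<close>. It is symmetric in \<open>g\<close>
  and \<open>h\<close>, and it occurs in the cyclic sum twice, with opposite signs. In the rest, \<open>A\<close>, the
  coefficient of \<open>f i * g j * h l\<close> is the cyclic sum of \<open>schouten\<close>.\<close>

lemma jacobi_pointwise:
  fixes p :: "'i::finite \<Rightarrow> 'i \<Rightarrow> real" and dp :: "'i \<Rightarrow> 'i \<Rightarrow> 'i \<Rightarrow> real"
  assumes anti: "\<And>i j. p i j = - p j i"
    and schouten: "\<And>i j l. schouten p dp i j l + schouten p dp j l i + schouten p dp l i j = 0"
    and sym: "\<And>i j. ff i j = ff j i" "\<And>i j. gg i j = gg j i" "\<And>i j. hh i j = hh j i"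
  defines "B \<equiv> \<lambda>u v. \<Sum>i\<in>UNIV. \<Sum>j\<in>UNIV. p i j * (u i * v j)"
  defines "D \<equiv> \<lambda>u v uu vv k. \<Sum>i\<in>UNIV. \<Sum>j\<in>UNIV.
      p i j * (u i * vv k j + uu k i * v j) + dp k i j * (u i * v j)"
  shows "B (D f g ff gg) h + B (D g h gg hh) f + B (D h f hh ff) g = 0"
proof -
  define ham where "ham v i = (\<Sum>j\<in>UNIV. p i j * v j)" for v i
  define A where "A u v w = (\<Sum>k\<in>UNIV. (\<Sum>i\<in>UNIV. \<Sum>j\<in>UNIV. dp k i j * (u i * v j)) * ham w k)"
    for u v w
  define T where "T uu v w = (\<Sum>k\<in>UNIV. \<Sum>i\<in>UNIV. uu k i * ham v i * ham w k)" for uu v w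
  have B: "B u v = (\<Sum>i\<in>UNIV. u i * ham v i)" for u v
    by (simp add: B_def ham_def sum_distrib_left mult_ac)
  have ham': "(\<Sum>i\<in>UNIV. p i j * u i) = - ham u j" for u j
    by (subst anti) (simp add: ham_def sum_negf)
  have D: "D u v uu vv k = (\<Sum>i\<in>UNIV. uu k i * ham v i) - (\<Sum>j\<in>UNIV. vv k j * ham u j)
      + (\<Sum>i\<in>UNIV. \<Sum>j\<in>UNIV. dp k i j * (u i * v j))" for u v uu vv k
  proof -
    have 1: "(\<Sum>i\<in>UNIV. \<Sum>j\<in>UNIV. p i j * (uu k i * v j)) = (\<Sum>i\<in>UNIV. uu k i * ham v i)"
      by (simp add: ham_def sum_distrib_left mult_ac)
    have "(\<Sum>i\<in>UNIV. \<Sum>j\<in>UNIV. p i j * (u i * vv k j))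
        = (\<Sum>j\<in>UNIV. vv k j * (\<Sum>i\<in>UNIV. p i j * u i))"
      by (subst sum.swap) (simp add: sum_distrib_left mult_ac)
    then have 2: "(\<Sum>i\<in>UNIV. \<Sum>j\<in>UNIV. p i j * (u i * vv k j)) = - (\<Sum>j\<in>UNIV. vv k j * ham u j)"
      by (simp add: ham' sum_negf)
    show ?thesis unfolding D_def using 1 2 by (simp add: distrib_left sum.distrib)
  qed
  have BD: "B (D u v uu vv) w = T uu v w - T vv u w + A u v w" for u v uu vv w
    by (simp add: B D T_def A_def distrib_right left_diff_distrib sum.distrib sum_subtractf
        sum_distrib_right)
  have T: "T uu v w = T uu w v" if "\<And>i j. uu i j = uu j i" for uu v w
    unfolding T_def by (subst sum.swap) (simp add: that mult_ac)
  have A: "A u v w = (\<Sum>i\<in>UNIV. \<Sum>j\<in>UNIV. \<Sum>l\<in>UNIV. schouten p dp i j l * (u i * v j * w l))"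
    for u v w
  proof -
    have "A u v w = (\<Sum>k\<in>UNIV. \<Sum>i\<in>UNIV. \<Sum>j\<in>UNIV. \<Sum>l\<in>UNIV. p k l * dp k i j * (u i * v j * w l))"
      by (simp add: A_def ham_def sum_distrib_left sum_distrib_right mult_ac)
    also have "\<dots> = (\<Sum>i\<in>UNIV. \<Sum>j\<in>UNIV. \<Sum>k\<in>UNIV. \<Sum>l\<in>UNIV. p k l * dp k i j * (u i * v j * w l))"
      by (rule sum_rotate[symmetric])
    also have "\<dots> = (\<Sum>i\<in>UNIV. \<Sum>j\<in>UNIV. \<Sum>l\<in>UNIV. \<Sum>k\<in>UNIV. p k l * dp k i j * (u i * v j * w l))"
      by (intro sum.cong refl sum.swap)
    finally show ?thesis by (simp add: schouten_def sum_distrib_right)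
  qed
  have "A g h f = (\<Sum>i\<in>UNIV. \<Sum>j\<in>UNIV. \<Sum>l\<in>UNIV. schouten p dp j l i * (f i * g j * h l))"
    unfolding A by (subst sum_rotate) (simp add: mult_ac)
  moreover have "A h f g = (\<Sum>i\<in>UNIV. \<Sum>j\<in>UNIV. \<Sum>l\<in>UNIV. schouten p dp l i j * (f i * g j * h l))"
    unfolding A by (subst sum_rotate[symmetric]) (simp add: mult_ac)
  ultimately have "A f g h + A g h f + A h f g = 0"
    using schouten
    by (simp add: A sum.distrib[symmetric] distrib_right[symmetric])
  then show ?thesis
    unfolding BD using T[of ff g h, OF sym(1)] T[of gg h f, OF sym(2)] T[of hh f g, OF sym(3)] by simp
qed

text \<open>The directions \<open>e i\<close> are constant, so the derivations along them commute; this is what the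
  Jacobi identity rests on.\<close>

definition bivector_bracket ::
  "('i::finite \<Rightarrow> 'a::real_normed_vector) \<Rightarrow> ('i \<Rightarrow> 'i \<Rightarrow> 'a \<Rightarrow> real)
    \<Rightarrow> ('a \<Rightarrow> real) \<Rightarrow> ('a \<Rightarrow> real) \<Rightarrow> 'a \<Rightarrow> real" where
  "bivector_bracket e P F G z =
    (\<Sum>i\<in>UNIV. \<Sum>j\<in>UNIV. P i j z * (dir_deriv (e i) F z * dir_deriv (e j) G z))"

lemma smooth_on_bivector_bracket:
  assumes "open M" "\<And>i j. smooth_on M (P i j)" "smooth_on M F" "smooth_on M G"
  shows "smooth_on M (bivector_bracket e P F G)"
proof -
  have "bivector_bracket e P F G =
      (\<lambda>z. \<Sum>i\<in>UNIV. \<Sum>j\<in>UNIV. P i j z * (dir_deriv (e i) F z * dir_deriv (e j) G z))"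
    by (simp add: fun_eq_iff bivector_bracket_def)
  then show ?thesis
    by (simp only:) (intro smooth_on_sum smooth_on_mult smooth_on_dir_deriv assms)
qed

lemma dir_deriv_bivector_bracket:
  assumes "open M" "\<And>i j. smooth_on M (P i j)" "smooth_on M F" "smooth_on M G" "z \<in> M"
  shows "dir_deriv v (bivector_bracket e P F G) z = (\<Sum>i\<in>UNIV. \<Sum>j\<in>UNIV.
      P i j z * (dir_deriv (e i) F z * dir_deriv v (dir_deriv (e j) G) z
        + dir_deriv v (dir_deriv (e i) F) z * dir_deriv (e j) G z)
      + dir_deriv v (P i j) z * (dir_deriv (e i) F z * dir_deriv (e j) G z))"
proof -
  have FG: "smooth_on M (\<lambda>z. dir_deriv (e i) F z * dir_deriv (e j) G z)" for i j
    by (intro smooth_on_mult smooth_on_dir_deriv assms)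
  have PFG: "smooth_on M (\<lambda>z. P i j z * (dir_deriv (e i) F z * dir_deriv (e j) G z))" for i j
    by (intro smooth_on_mult FG assms)
  have diff: "f differentiable (at z)" if "smooth_on M f" for f :: "'a \<Rightarrow> real"
    using that assms(5) smooth_on_differentiable by blast
  have "bivector_bracket e P F G =
      (\<lambda>z. \<Sum>i\<in>UNIV. \<Sum>j\<in>UNIV. P i j z * (dir_deriv (e i) F z * dir_deriv (e j) G z))"
    by (simp add: fun_eq_iff bivector_bracket_def)
  then show ?thesis
    by (simp add: dir_deriv_sum dir_deriv_mult assms(1) smooth_on_sum[OF assms(1)]
        PFG FG diff smooth_on_dir_deriv assms(2-4))
qed

lemma poisson_bracket_on_bivector_bracket:
  fixes e :: "'i::finite \<Rightarrow> 'a::real_normed_vector"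
  assumes M: "open M" and P: "\<And>i j. smooth_on M (P i j)"
    and anti: "\<And>i j z. P i j z = - P j i z"
    and schouten: "\<And>i j l z. z \<in> M \<Longrightarrow>
      (let S = schouten (\<lambda>i j. P i j z) (\<lambda>k i j. dir_deriv (e k) (P i j) z)
       in S i j l + S j l i + S l i j = 0)"
  shows "poisson_bracket_on M (bivector_bracket e P)"
proof -
  have diff: "F differentiable (at z)" if "smooth_on M F" "z \<in> M" for F :: "'a \<Rightarrow> real" and z
    using that smooth_on_differentiable by blast
  have cong: "bivector_bracket e P F G z = bivector_bracket e P F' G' z"
    if "\<forall>z\<in>M. F z = F' z" "\<forall>z\<in>M. G z = G' z" "z \<in> M" for F F' G G' z
  proof -
    have "dir_deriv v F z = dir_deriv v F' z" "dir_deriv v G z = dir_deriv v G' z" for v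
      using that by (auto intro: dir_deriv_cong[OF M])
    then show ?thesis by (simp add: bivector_bracket_def)
  qed
  have skew: "bivector_bracket e P F G z = - bivector_bracket e P G F z" for F G z
    unfolding bivector_bracket_def
    by (subst sum.swap, subst anti) (simp add: sum_negf mult_ac)
  have linear_left: "bivector_bracket e P (\<lambda>w. a * F w + b * G w) H z
      = a * bivector_bracket e P F H z + b * bivector_bracket e P G H z"
    if "smooth_on M F" "smooth_on M G" "z \<in> M" for F G H a b z
  proof -
    have "(\<lambda>w. c * F w) differentiable (at z)" if "smooth_on M F" for c and F :: "'a \<Rightarrow> real"
      using diff smooth_on_mult[OF M smooth_on_const that] \<open>z \<in> M\<close> by blast
    then have "dir_deriv v (\<lambda>w. a * F w + b * G w) z = a * dir_deriv v F z + b * dir_deriv v G z"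
      for v using that by (simp add: dir_deriv_add dir_deriv_cmult diff)
    then show ?thesis
      by (simp add: bivector_bracket_def sum_distrib_left sum.distrib[symmetric] algebra_simps)
  qed
  have leibniz: "bivector_bracket e P (\<lambda>w. F w * G w) H z
      = F z * bivector_bracket e P G H z + G z * bivector_bracket e P F H z"
    if "smooth_on M F" "smooth_on M G" "z \<in> M" for F G H z
    using that
    by (simp add: bivector_bracket_def dir_deriv_mult diff sum_distrib_left sum.distrib[symmetric]
        algebra_simps)
  have jacobi: "bivector_bracket e P (bivector_bracket e P F G) H z
      + bivector_bracket e P (bivector_bracket e P G H) F z
      + bivector_bracket e P (bivector_bracket e P H F) G z = 0"
    if smooth: "smooth_on M F" "smooth_on M G" "smooth_on M H" and z: "z \<in> M" for F G H z
    unfolding bivector_bracket_def[of e P "bivector_bracket e P F G"]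
      bivector_bracket_def[of e P "bivector_bracket e P G H"]
      bivector_bracket_def[of e P "bivector_bracket e P H F"]
      dir_deriv_bivector_bracket[OF M P smooth(1,2) z, where e = e]
      dir_deriv_bivector_bracket[OF M P smooth(2,3) z, where e = e]
      dir_deriv_bivector_bracket[OF M P smooth(3,1) z, where e = e]
  proof (rule jacobi_pointwise[where p = "\<lambda>i j. P i j z"
        and dp = "\<lambda>k i j. dir_deriv (e k) (P i j) z"
        and ff = "\<lambda>k i. dir_deriv (e k) (dir_deriv (e i) F) z"
        and gg = "\<lambda>k i. dir_deriv (e k) (dir_deriv (e i) G) z"
        and hh = "\<lambda>k i. dir_deriv (e k) (dir_deriv (e i) H) z"])
    show "P i j z = - P j i z" for i j by (rule anti)
  qed (use schouten[OF z] in \<open>simp add: Let_def\<close>, (rule dir_deriv_commute[OF M _ z], fact)+)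
  show ?thesis
    unfolding poisson_bracket_on_def
  proof (intro conjI allI impI ballI)
    fix F G H :: "'a \<Rightarrow> real" and a b z
    assume smooth: "smooth_on M F" "smooth_on M G" and z: "z \<in> M"
    show "bivector_bracket e P H (\<lambda>w. a * F w + b * G w) z
        = a * bivector_bracket e P H F z + b * bivector_bracket e P H G z"
      using linear_left[OF smooth z, of a b H] skew[of H] by simp
  qed (rule smooth_on_bivector_bracket[OF M P] cong linear_left skew leibniz jacobi; assumption)+
qed

section \<open>The particle bracket\<close>

text \<open>For a linear map \<open>D\<close> on \<open>\<real>\<^sup>3\<close>, the derivative at \<open>0\<close> of \<open>t \<mapsto> det (1 + t D)\<close> is the trace; the
  identity is this fact, written out for the determinant of basis vectors. It is where the
  divergence comes from.\<close>

lemma trace_triple_product: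
  fixes D :: "3 \<Rightarrow> real^3"
  shows "D c \<bullet> cross3 (axis a 1) (axis b 1) + D a \<bullet> cross3 (axis b 1) (axis c 1)
      + D b \<bullet> cross3 (axis c 1) (axis a 1)
    = (\<Sum>i\<in>UNIV. D i $ i) * (axis a 1 \<bullet> cross3 (axis b 1) (axis c 1))"
  using exhaust_3[of a] exhaust_3[of b] exhaust_3[of c]
  by (auto simp: cross3_def axis_def inner_vec_def sum_3)

lemma inner_cross3_expand:
  fixes w x y :: "real^3"
  shows "w \<bullet> cross3 x y
    = (\<Sum>a\<in>UNIV. \<Sum>b\<in>UNIV. (w \<bullet> cross3 (axis a 1) (axis b 1)) * (x $ a * y $ b))"
  by (simp add: cross3_def axis_def inner_vec_def sum_3 algebra_simps)

text \<open>Index of a phase-space coordinate: \<open>Inl (s, a)\<close> is component \<open>a\<close> of the position of particle \<open>s\<close>,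
  and \<open>Inr (s, a)\<close> is component \<open>a\<close> of its velocity.\<close>

fun phase_dir :: "('n::finite \<times> 3) + ('n \<times> 3) \<Rightarrow> 'n phase" where
  "phase_dir (Inl p) = (axis (fst p) (axis (snd p) 1), 0)"
| "phase_dir (Inr p) = (0, axis (fst p) (axis (snd p) 1))"

fun particle_tensor ::
  "('n::finite \<Rightarrow> real) \<Rightarrow> (real^3 \<Rightarrow> real^3) \<Rightarrow>
   ('n \<times> 3) + ('n \<times> 3) \<Rightarrow> ('n \<times> 3) + ('n \<times> 3) \<Rightarrow> 'n phase \<Rightarrow> real" where
  "particle_tensor \<omega> B (Inl p) (Inl q) = (\<lambda>_. 0)"
| "particle_tensor \<omega> B (Inl p) (Inr q) = (\<lambda>_. if p = q then 1 / \<omega> (fst p) else 0)"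
| "particle_tensor \<omega> B (Inr p) (Inl q) = (\<lambda>_. if p = q then - 1 / \<omega> (fst p) else 0)"
| "particle_tensor \<omega> B (Inr p) (Inr q) = (if fst p = fst q
     then (\<lambda>z. 1 / \<omega> (fst p) * (B (fst z $ fst p) \<bullet> cross3 (axis (snd p) 1) (axis (snd q) 1)))
     else (\<lambda>_. 0))"

lemma sum_UNIV_sum:
  "(\<Sum>i\<in>UNIV. f i) = (\<Sum>a\<in>UNIV. f (Inl a)) + (\<Sum>b\<in>UNIV. f (Inr b))"
  for f :: "'a::finite + 'b::finite \<Rightarrow> 'c::comm_monoid_add"
  by (simp add: UNIV_Plus_UNIV[symmetric] sum.Plus del: UNIV_Plus_UNIV)

lemma sum_UNIV_prod:
  "(\<Sum>p\<in>UNIV. f p) = (\<Sum>a\<in>UNIV. \<Sum>b\<in>UNIV. f (a, b))"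
  for f :: "'a::finite \<times> 'b::finite \<Rightarrow> 'c::comm_monoid_add"
  by (simp add: sum.cartesian_product UNIV_Times_UNIV[symmetric] del: UNIV_Times_UNIV)

lemma sum_sum_diagonal:
  fixes c :: "'p::finite \<Rightarrow> real"
  shows "(\<Sum>p\<in>UNIV. \<Sum>q\<in>UNIV. (if p = q then c p else 0) * X p q) = (\<Sum>p\<in>UNIV. c p * X p p)"
  by (simp add: if_distrib[of "\<lambda>x. x * _"] cong: if_cong)

lemma particle_bracket_eq:
  fixes \<omega> :: "'n::finite \<Rightarrow> real"
  shows "particle_bracket \<omega> B = bivector_bracket phase_dir (particle_tensor \<omega> B)"
proof (intro ext)
  fix F G :: "'n phase \<Rightarrow> real" and z
  have X: "dir_deriv (phase_dir (Inl (s, a))) K z = grad_X s K z $ a"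
    and V: "dir_deriv (phase_dir (Inr (s, a))) K z = grad_V s K z $ a" for s a
      and K :: "'n phase \<Rightarrow> real"
    by (simp_all add: dir_deriv_def grad_X_def grad_V_def)
  have canonical: "(\<Sum>p\<in>UNIV. \<Sum>q\<in>UNIV. particle_tensor \<omega> B (Inl p) (Inr q) z
      * (dir_deriv (phase_dir (Inl p)) F z * dir_deriv (phase_dir (Inr q)) G z))
    = (\<Sum>s\<in>UNIV. 1 / \<omega> s * (grad_X s F z \<bullet> grad_V s G z))" for F G :: "'n phase \<Rightarrow> real"
    unfolding particle_tensor.simps sum_sum_diagonal
    by (simp add: sum_UNIV_prod X V inner_vec_def sum_distrib_left
        del: phase_dir.simps)
  have "(\<Sum>p\<in>UNIV. \<Sum>q\<in>UNIV. particle_tensor \<omega> B (Inr p) (Inl q) z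
      * (dir_deriv (phase_dir (Inr p)) F z * dir_deriv (phase_dir (Inl q)) G z))
    = - (\<Sum>s\<in>UNIV. 1 / \<omega> s * (grad_X s G z \<bullet> grad_V s F z))"
    unfolding particle_tensor.simps sum_sum_diagonal
    by (simp add: sum_UNIV_prod X V inner_vec_def sum_distrib_left sum_negf mult_ac
        del: phase_dir.simps)
  moreover have "(\<Sum>p\<in>UNIV. \<Sum>q\<in>UNIV. particle_tensor \<omega> B (Inr p) (Inr q) z
      * (dir_deriv (phase_dir (Inr p)) F z * dir_deriv (phase_dir (Inr q)) G z))
    = (\<Sum>s\<in>UNIV. 1 / \<omega> s * (B (fst z $ s) \<bullet> cross3 (grad_V s F z) (grad_V s G z)))"
  proof -
    define T where "T s a b = 1 / \<omega> s * (B (fst z $ s) \<bullet> cross3 (axis a 1) (axis b 1))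
        * (grad_V s F z $ a * grad_V s G z $ b)" for s a b
    have "(\<Sum>b\<in>UNIV. particle_tensor \<omega> B (Inr (s, a)) (Inr (t, b)) z
        * (dir_deriv (phase_dir (Inr (s, a))) F z * dir_deriv (phase_dir (Inr (t, b))) G z))
      = (if s = t then \<Sum>b\<in>UNIV. T s a b else 0)" for s a t
      by (simp add: T_def V del: phase_dir.simps)
    then have "(\<Sum>p\<in>UNIV. \<Sum>q\<in>UNIV. particle_tensor \<omega> B (Inr p) (Inr q) z
        * (dir_deriv (phase_dir (Inr p)) F z * dir_deriv (phase_dir (Inr q)) G z))
      = (\<Sum>s\<in>UNIV. \<Sum>a\<in>UNIV. \<Sum>b\<in>UNIV. T s a b)"
      by (simp add: sum_UNIV_prod del: phase_dir.simps particle_tensor.simps)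
    also have "\<dots> = (\<Sum>s\<in>UNIV. 1 / \<omega> s * (B (fst z $ s) \<bullet> cross3 (grad_V s F z) (grad_V s G z)))"
      by (subst inner_cross3_expand) (simp add: T_def sum_distrib_left mult.assoc)
    finally show ?thesis .
  qed
  ultimately show "particle_bracket \<omega> B F G z
      = bivector_bracket phase_dir (particle_tensor \<omega> B) F G z"
    using canonical[of F G]
    by (simp add: particle_bracket_def bivector_bracket_def sum_UNIV_sum sum.distrib
        right_diff_distrib sum_subtractf)
qed

lemma open_phase_space:
  assumes "open \<Omega>"
  shows "open (phase_space \<Omega> :: 'n::finite phase set)"
proof -
  have "(phase_space \<Omega> :: 'n phase set) = (\<Inter>s. (\<lambda>z. fst z $ s) -` \<Omega>)"
    by (auto simp: phase_space_def)
  moreover have "open ((\<lambda>z :: 'n phase. fst z $ s) -` \<Omega>)" for s :: 'n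
    by (intro open_vimage assms continuous_intros)
  ultimately show ?thesis by (simp add: open_INT)
qed

lemma bounded_linear_position: "bounded_linear (\<lambda>z :: 'n::finite phase. fst z $ s)"
  by (intro bounded_linear_compose[OF bounded_linear_vec_nth] bounded_linear_fst)

lemma particle_tensor_antisym: "particle_tensor \<omega> B i j z = - particle_tensor \<omega> B j i z"
proof (cases i; cases j)
  fix p q assume "i = Inr p" "j = Inr q"
  then show ?thesis
    using cross_skew[of "axis (snd p) 1" "axis (snd q) 1"] by simp
qed auto

lemma smooth_on_particle_tensor:
  fixes \<omega> :: "'n::finite \<Rightarrow> real"
  assumes "open \<Omega>" "smooth_on \<Omega> B"
  shows "smooth_on (phase_space \<Omega>) (particle_tensor \<omega> B i j)"
proof -
  have "smooth_on (phase_space \<Omega>) (\<lambda>z :: 'n phase. B (fst z $ s) \<bullet> c)" for s c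
    using assms unfolding smooth_on_def
    by (intro allI k_smooth_on_bounded_linear_left[OF open_phase_space[OF assms(1)]
          bounded_linear_inner_left]
        k_smooth_on_bounded_linear_right[OF open_phase_space[OF assms(1)]
          bounded_linear_position, where S = \<Omega>])
      (auto simp: phase_space_def)
  then have B: "smooth_on (phase_space \<Omega>) (\<lambda>z :: 'n phase. a * (B (fst z $ s) \<bullet> c))" for a s c
    by (intro smooth_on_mult smooth_on_const open_phase_space assms)
  show ?thesis
  proof (cases i; cases j)
    fix p q assume "i = Inr p" "j = Inr q"
    then show ?thesis
      using B[of "1 / \<omega> (fst q)" "fst q" "cross3 (axis (snd p) 1) (axis (snd q) 1)"]
      by (simp add: smooth_on_const)
  qed (simp_all add: smooth_on_const)
qed

lemma dir_deriv_particle_tensor: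
  assumes "open \<Omega>" "smooth_on \<Omega> B" "z \<in> phase_space \<Omega>"
  shows "dir_deriv (phase_dir k) (particle_tensor \<omega> B i j) z =
    (case (k, i, j) of
      (Inl r, Inr p, Inr q) \<Rightarrow> (if fst p = fst q \<and> fst r = fst p
        then 1 / \<omega> (fst p) * (dir_deriv (axis (snd r) 1) B (fst z $ fst p)
          \<bullet> cross3 (axis (snd p) 1) (axis (snd q) 1)) else 0)
    | _ \<Rightarrow> 0)"
proof -
  have B: "B differentiable (at (fst z $ s))" for s
    using assms by (auto simp: phase_space_def intro: smooth_on_differentiable)
  have deriv: "dir_deriv v (\<lambda>z. a * (B (fst z $ s) \<bullet> c)) z
      = a * (dir_deriv (fst v $ s) B (fst z $ s) \<bullet> c)" for v a s c
  proof -
    have "((\<lambda>z. a * (B (fst z $ s) \<bullet> c)) has_derivative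
        (\<lambda>v. a * (dir_deriv (fst v $ s) B (fst z $ s) \<bullet> c))) (at z)"
      by (intro has_derivative_mult_right has_derivative_inner_left
          has_derivative_bounded_linear_right[OF bounded_linear_position] B)
    then show ?thesis by (rule dir_deriv_eqI)
  qed
  show ?thesis
  proof (cases i; cases j)
    fix p q assume ij: "i = Inr p" "j = Inr q"
    show ?thesis
    proof (cases "fst p = fst q")
      case True
      then have "particle_tensor \<omega> B i j = (\<lambda>z. 1 / \<omega> (fst p) * (B (fst z $ fst p)
          \<bullet> cross3 (axis (snd p) 1) (axis (snd q) 1)))"
        by (simp add: ij fun_eq_iff)
      then show ?thesis
        using True by (cases k) (simp_all only: deriv, auto simp: ij axis_def dir_deriv_zero[OF B])
    next
      case False
      then have "particle_tensor \<omega> B i j = (\<lambda>_. 0)" by (simp add: ij fun_eq_iff)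
      then show ?thesis using False by (simp add: dir_deriv_const ij split: sum.split)
    qed
  qed (simp_all add: dir_deriv_const split: sum.split)
qed

lemma schouten_particle_tensor:
  assumes "open \<Omega>" "smooth_on \<Omega> B" "z \<in> phase_space \<Omega>"
  shows "schouten (\<lambda>i j. particle_tensor \<omega> B i j z)
      (\<lambda>k i j. dir_deriv (phase_dir k) (particle_tensor \<omega> B i j) z) i j l =
    (case (i, j, l) of
      (Inr p, Inr q, Inr r) \<Rightarrow> (if fst p = fst q \<and> fst r = fst p
        then (1 / \<omega> (fst p))\<^sup>2 * (dir_deriv (axis (snd r) 1) B (fst z $ fst p)
          \<bullet> cross3 (axis (snd p) 1) (axis (snd q) 1)) else 0)
    | _ \<Rightarrow> 0)"
proof -
  define D where "D k = dir_deriv (phase_dir k) (particle_tensor \<omega> B i j) z" for k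
  have D: "D (Inr r) = 0" for r
    unfolding D_def dir_deriv_particle_tensor[OF assms] by simp
  have "(\<Sum>k\<in>UNIV. particle_tensor \<omega> B k l z * D k) =
      (case l of Inl _ \<Rightarrow> 0 | Inr r \<Rightarrow> 1 / \<omega> (fst r) * D (Inl r))"
  proof (cases l)
    case (Inr r)
    have "(\<Sum>k\<in>UNIV. particle_tensor \<omega> B k l z * D k)
        = (\<Sum>p\<in>UNIV. if p = r then 1 / \<omega> (fst p) * D (Inl p) else 0)"
      unfolding sum_UNIV_sum by (simp add: Inr D if_distrib[of "\<lambda>x. x * _"] cong: if_cong)
    then show ?thesis by (simp add: Inr)
  qed (simp add: sum_UNIV_sum D)
  then have "schouten (\<lambda>i j. particle_tensor \<omega> B i j z)
      (\<lambda>k i j. dir_deriv (phase_dir k) (particle_tensor \<omega> B i j) z) i j l =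
      (case l of Inl _ \<Rightarrow> 0 | Inr r \<Rightarrow> 1 / \<omega> (fst r) * D (Inl r))"
    unfolding schouten_def D_def .
  then show ?thesis
    unfolding D_def dir_deriv_particle_tensor[OF assms]
    by (cases i; cases j; cases l) (simp_all add: power2_eq_square)
qed

theorem mainTheorem2:
  fixes \<omega> :: "'n::finite \<Rightarrow> real" and \<Omega> :: "(real^3) set" and B\<^sub>0 :: "real^3 \<Rightarrow> real^3"
  assumes "\<And>s. \<omega> s \<noteq> 0"
    and "open \<Omega>"
    and "smooth_on \<Omega> B\<^sub>0"
    and "\<And>x. x \<in> \<Omega> \<Longrightarrow> divergence B\<^sub>0 x = 0"
  shows "poisson_bracket_on (phase_space \<Omega> :: 'n phase set) (particle_bracket \<omega> B\<^sub>0)"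
  unfolding particle_bracket_eq
proof (rule poisson_bracket_on_bivector_bracket)
  show "open (phase_space \<Omega> :: 'n phase set)" by (rule open_phase_space) fact
  show "smooth_on (phase_space \<Omega>) (particle_tensor \<omega> B\<^sub>0 i j)" for i j
    by (rule smooth_on_particle_tensor) fact+
  show "particle_tensor \<omega> B\<^sub>0 i j z = - particle_tensor \<omega> B\<^sub>0 j i z" for i j z
    by (rule particle_tensor_antisym)
  fix i j l :: "('n \<times> 3) + ('n \<times> 3)" and z :: "'n phase"
  assume z: "z \<in> phase_space \<Omega>"
  have div: "(\<Sum>a\<in>UNIV. dir_deriv (axis a 1) B\<^sub>0 (fst z $ s) $ a) = 0" for s
    using assms(4)[of "fst z $ s"] z by (auto simp: phase_space_def divergence_def dir_deriv_def)
  have cyclic: "w * (dir_deriv (axis c 1) B\<^sub>0 (fst z $ s) \<bullet> cross3 (axis a 1) (axis b 1))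
      + w * (dir_deriv (axis a 1) B\<^sub>0 (fst z $ s) \<bullet> cross3 (axis b 1) (axis c 1))
      + w * (dir_deriv (axis b 1) B\<^sub>0 (fst z $ s) \<bullet> cross3 (axis c 1) (axis a 1)) = 0" for w a b c s
    using trace_triple_product[of "\<lambda>i. dir_deriv (axis i 1) B\<^sub>0 (fst z $ s)" c a b]
    by (simp add: div distrib_left[symmetric])
  show "let S = schouten (\<lambda>i j. particle_tensor \<omega> B\<^sub>0 i j z)
        (\<lambda>k i j. dir_deriv (phase_dir k) (particle_tensor \<omega> B\<^sub>0 i j) z)
      in S i j l + S j l i + S l i j = 0"
    unfolding Let_def schouten_particle_tensor[OF assms(2,3) z]
    by (cases i; cases j; cases l) (auto simp: cyclic)
qed

end
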